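(* Let $\mathbf{k}$ be a field and let $(A,\cdot,\circ)$ be a finite-dimensional Jacobi Novikov-Poisson algebra over $\mathbf{k}$. Then the following conditions are equivalent. (a) $(A,\cdot,\circ)$ is a Frobenius Jacobi Novikov-Poisson algebra. (b) There exists a bilinear form $\mathcal{B}(\cdot,\cdot)$ on $A$ such that $(A,\cdot,\circ,\mathcal{B}(\cdot,\cdot))$ is a quadratic Jacobi Novikov-Poisson algebra. (c) There exists a nondegenerate integral on $(A,\cdot,\circ)$. (d) There exists a pair $(v,e=\sum e^1\otimes e^2)$, where $v$ is an integral on $(A,\cdot,\circ)$ and $e=\sum e^1\otimes e^2\in A\otimes A$ is an element such that for every $a\in A$ $$\sum a\cdot e^1\otimes e^2=\sum e^1\otimes e^2\cdot a,\qquad \sum v(e^1)\,e^2=\sum e^1\,v(e^2)=1_A.$$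
   Context: All vector spaces and algebras are over $\mathbf{k}$; binary operations are bilinear. A Novikov algebra $(A,\circ)$ is a vector space with a binary operation satisfying $(a\circ b)\circ c-a\circ(b\circ c)=(b\circ a)\circ c-b\circ(a\circ c)$ and $(a\circ b)\circ c=(a\circ c)\circ b$. A Jacobi Novikov-Poisson algebra is a triple $(A,\cdot,\circ)$ where $(A,\cdot)$ is a unital commutative associative algebra with identity $1_A$, $(A,\circ)$ is a Novikov algebra, and $(a\cdot b)\circ c=a\cdot(b\circ c)$, $c\circ(a\cdot b)=(c\circ a)\cdot b+a\cdot(c\circ b)-a\cdot b\cdot(c\circ 1_A)$ for all $a,b,c\in A$. Modules. A bimodule of a Novikov algebra $(A,\circ)$ is $(V,l_A,r_A)$ with $V$ a vector space and $l_A,r_A:A\to\mathrm{End}_{\mathbf{k}}(V)$ linear such that for all $a,b\in A$, $v\in V$: $l_A(a)l_A(b)v-l_A(a\circ b)v=l_A(b)l_A(a)v-l_A(b\circ a)v$; $l_A(a)r_A(b)v-r_A(b)l_A(a)v=r_A(a\circ b)v-r_A(b)r_A(a)v$; $l_A(a\circ b)v=r_A(b)l_A(a)v$; $r_A(a)r_A(b)v=r_A(b)r_A(a)v$. A module of $(A,\cdot,\circ)$ is $(V,l_A,r_A,\sigma)$ with $(V,l_A,r_A)$ a bimodule of $(A,\circ)$, $(V,\sigma)$ a (unital) module of $(A,\cdot)$, and for all $a,b\in A$, $v\in V$: $r_A(b)(\sigma(a)v)=\sigma(a)(r_A(b)v)=\sigma(a\circ b)v$; $l_A(a\cdot b)v=\sigma(a)(l_A(b)v)$;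 $l_A(a)(\sigma(b)v)-\sigma(b)(l_A(a)v)=\sigma(a\circ b)v-\sigma(a\circ 1_A)(\sigma(b)v)$; $r_A(a\cdot b)v-\sigma(b)(r_A(a)v)=\sigma(a)(r_A(b)v)-\sigma(a\cdot b)(r_A(1_A)v)$. Isomorphisms of modules are linear bijections commuting with $l_A$, $r_A$ and $\sigma$. For a binary operation $\ast$ on $A$ put $L_{A,\ast}(a)(b)=a\ast b$, $R_{A,\ast}(a)(b)=b\ast a$. For linear $\varphi:A\to\mathrm{End}_{\mathbf{k}}(V)$ define $\varphi^*:A\to\mathrm{End}_{\mathbf{k}}(V^* )$ by $\langle\varphi^*(a)f,v\rangle=-\langle f,\varphi(a)v\rangle$. Then $(A,L_{A,\circ},R_{A,\circ},L_{A,\cdot})$ and $(A^*,L_{A,\circ}^*+R_{A,\circ}^*,-R_{A,\circ}^*,-L_{A,\cdot}^* )$ are modules of $(A,\cdot,\circ)$; a finite-dimensional $(A,\cdot,\circ)$ is called Frobenius if these two modules are isomorphic. A quadratic Jacobi Novikov-Poisson algebra is $(A,\cdot,\circ,\mathcal{B}(\cdot,\cdot))$ with $(A,\cdot,\circ)$ a Jacobi Novikov-Poisson algebra and $\mathcal{B}$ a nondegenerate symmetric bilinear form on $A$ with $\mathcal{B}(a\cdot b,c)=\mathcal{B}(a,b\cdot c)$ and $\mathcal{B}(a\circ b,c)=-\mathcal{B}(b,a\circ c+c\circ a)$ for all $a,b,c\in A$. An integral on $(A,\cdot,\circ)$ is $v\in A^*$ with $v((a\circ b)\cdot c)=-v(b\cdot(a\circ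 c+c\circ a))$ for all $a,b,c\in A$; it is nondegenerate if $v(a\cdot b)=0$ for all $b\in A$ implies $a=0$. *)

theory Defs
  imports Complex_Main "HOL-Library.Function_Algebras" "HOL-Library.Poly_Mapping" "HOL-Library.FuncSet"
begin

(* The field is the type 'k, the algebra A is the whole of a type 'a carrying the scalar
   multiplication s.  Modules over A live on a subspace V of an ambient vector space, because the
   dual of A is only a subspace of the vector space of all functions from 'a to 'k. *)

definition bilinear_map ::
  "('k::field \<Rightarrow> 'a::ab_group_add \<Rightarrow> 'a) \<Rightarrow> ('k \<Rightarrow> 'b::ab_group_add \<Rightarrow> 'b) \<Rightarrow>
   ('k \<Rightarrow> 'c::ab_group_add \<Rightarrow> 'c) \<Rightarrow> ('a \<Rightarrow> 'b \<Rightarrow> 'c) \<Rightarrow> bool"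
  where "bilinear_map s1 s2 s3 f \<longleftrightarrow>
    (\<forall>x. Vector_Spaces.linear s2 s3 (f x)) \<and> (\<forall>y. Vector_Spaces.linear s1 s3 (\<lambda>x. f x y))"

definition linear_between ::
  "('k::field \<Rightarrow> 'v::ab_group_add \<Rightarrow> 'v) \<Rightarrow> 'v set \<Rightarrow>
   ('k \<Rightarrow> 'w::ab_group_add \<Rightarrow> 'w) \<Rightarrow> 'w set \<Rightarrow> ('v \<Rightarrow> 'w) \<Rightarrow> bool"
  where "linear_between sV V sW W f \<longleftrightarrow>
    f \<in> V \<rightarrow> W \<and> (\<forall>x\<in>V. \<forall>y\<in>V. f (x + y) = f x + f y) \<and> (\<forall>c. \<forall>x\<in>V. f (sV c x) = sW c (f x))"

(* \<phi> is a linear map from A to End(V) *)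
definition linear_to_End ::
  "('k::field \<Rightarrow> 'a::ab_group_add \<Rightarrow> 'a) \<Rightarrow> ('k \<Rightarrow> 'v::ab_group_add \<Rightarrow> 'v) \<Rightarrow> 'v set \<Rightarrow>
   ('a \<Rightarrow> 'v \<Rightarrow> 'v) \<Rightarrow> bool"
  where "linear_to_End s sV V \<phi> \<longleftrightarrow>
    (\<forall>a. linear_between sV V sV V (\<phi> a)) \<and> (\<forall>v\<in>V. linear_between s UNIV sV V (\<lambda>a. \<phi> a v))"

locale novikov_algebra = vector_space s
  for s :: "'k::field \<Rightarrow> 'a::ab_group_add \<Rightarrow> 'a" +
  fixes circ :: "'a \<Rightarrow> 'a \<Rightarrow> 'a"
  assumes circ_bilinear: "bilinear_map s s s circ"
    and circ_left_symmetric: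
      "circ (circ a b) c - circ a (circ b c) = circ (circ b a) c - circ b (circ a c)"
    and circ_right_commute: "circ (circ a b) c = circ (circ a c) b"

locale jacobi_novikov_poisson = novikov_algebra s circ
  for s :: "'k::field \<Rightarrow> 'a::ab_group_add \<Rightarrow> 'a"
    and mult :: "'a \<Rightarrow> 'a \<Rightarrow> 'a" and one :: 'a and circ :: "'a \<Rightarrow> 'a \<Rightarrow> 'a" +
  assumes mult_bilinear: "bilinear_map s s s mult"
    and mult_assoc: "mult (mult a b) c = mult a (mult b c)"
    and mult_commute: "mult a b = mult b a"
    and mult_one: "mult one a = a"
    and circ_mult_left: "circ (mult a b) c = mult a (circ b c)"
    and circ_mult_right:
      "circ c (mult a b)
        = mult (circ c a) b + mult a (circ c b) - mult (mult a b) (circ c one)"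

definition finite_dimensional :: "('k::field \<Rightarrow> 'a::ab_group_add \<Rightarrow> 'a) \<Rightarrow> bool"
  where "finite_dimensional s \<longleftrightarrow> (\<exists>Basis. finite_dimensional_vector_space s Basis)"


locale novikov_bimodule = novikov_algebra s circ + V: vector_space sV
  for s :: "'k::field \<Rightarrow> 'a::ab_group_add \<Rightarrow> 'a" and circ :: "'a \<Rightarrow> 'a \<Rightarrow> 'a"
    and sV :: "'k \<Rightarrow> 'v::ab_group_add \<Rightarrow> 'v" and V :: "'v set"
    and l r :: "'a \<Rightarrow> 'v \<Rightarrow> 'v" +
  assumes subspace_V: "V.subspace V"
    and l_linear: "linear_to_End s sV V l"
    and r_linear: "linear_to_End s sV V r"
    and l_l: "v \<in> V \<Longrightarrow> l a (l b v) - l (circ a b) v = l b (l a v) - l (circ b a) v"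
    and l_r: "v \<in> V \<Longrightarrow> l a (r b v) - r b (l a v) = r (circ a b) v - r b (r a v)"
    and l_circ: "v \<in> V \<Longrightarrow> l (circ a b) v = r b (l a v)"
    and r_r: "v \<in> V \<Longrightarrow> r a (r b v) = r b (r a v)"

locale jnp_module = jacobi_novikov_poisson s mult one circ + novikov_bimodule s circ sV V l r
  for s :: "'k::field \<Rightarrow> 'a::ab_group_add \<Rightarrow> 'a"
    and mult :: "'a \<Rightarrow> 'a \<Rightarrow> 'a" and one :: 'a and circ :: "'a \<Rightarrow> 'a \<Rightarrow> 'a"
    and sV :: "'k \<Rightarrow> 'v::ab_group_add \<Rightarrow> 'v" and V :: "'v set"
    and l r \<sigma> :: "'a \<Rightarrow> 'v \<Rightarrow> 'v" +
  assumes \<sigma>_linear: "linear_to_End s sV V \<sigma>"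
    and \<sigma>_mult: "v \<in> V \<Longrightarrow> \<sigma> (mult a b) v = \<sigma> a (\<sigma> b v)"
    and \<sigma>_one: "v \<in> V \<Longrightarrow> \<sigma> one v = v"
    and r_\<sigma>: "v \<in> V \<Longrightarrow> r b (\<sigma> a v) = \<sigma> a (r b v)"
    and \<sigma>_r: "v \<in> V \<Longrightarrow> \<sigma> a (r b v) = \<sigma> (circ a b) v"
    and l_mult: "v \<in> V \<Longrightarrow> l (mult a b) v = \<sigma> a (l b v)"
    and l_\<sigma>: "v \<in> V \<Longrightarrow>
      l a (\<sigma> b v) - \<sigma> b (l a v) = \<sigma> (circ a b) v - \<sigma> (circ a one) (\<sigma> b v)"
    and r_mult: "v \<in> V \<Longrightarrow>
      r (mult a b) v - \<sigma> b (r a v) = \<sigma> a (r b v) - \<sigma> (mult a b) (r one v)"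

definition jnp_modules_isomorphic ::
  "('k::field \<Rightarrow> 'v::ab_group_add \<Rightarrow> 'v) \<Rightarrow> 'v set \<Rightarrow>
   ('a \<Rightarrow> 'v \<Rightarrow> 'v) \<Rightarrow> ('a \<Rightarrow> 'v \<Rightarrow> 'v) \<Rightarrow> ('a \<Rightarrow> 'v \<Rightarrow> 'v) \<Rightarrow>
   ('k \<Rightarrow> 'w::ab_group_add \<Rightarrow> 'w) \<Rightarrow> 'w set \<Rightarrow>
   ('a \<Rightarrow> 'w \<Rightarrow> 'w) \<Rightarrow> ('a \<Rightarrow> 'w \<Rightarrow> 'w) \<Rightarrow> ('a \<Rightarrow> 'w \<Rightarrow> 'w) \<Rightarrow> bool"
  where "jnp_modules_isomorphic sV V l r \<sigma> sW W l' r' \<sigma>' \<longleftrightarrow>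
    (\<exists>f. linear_between sV V sW W f \<and> bij_betw f V W \<and>
      (\<forall>a. \<forall>v\<in>V. f (l a v) = l' a (f v) \<and> f (r a v) = r' a (f v) \<and> f (\<sigma> a v) = \<sigma>' a (f v)))"


definition fun_scale :: "'k::field \<Rightarrow> ('a \<Rightarrow> 'k) \<Rightarrow> 'a \<Rightarrow> 'k"
  where "fun_scale c f = (\<lambda>x. c * f x)"

definition dual :: "('k::field \<Rightarrow> 'a::ab_group_add \<Rightarrow> 'a) \<Rightarrow> ('a \<Rightarrow> 'k) set"
  where "dual s = {f. Vector_Spaces.linear s (*) f}"

definition L_op :: "('a \<Rightarrow> 'a \<Rightarrow> 'a) \<Rightarrow> 'a \<Rightarrow> 'a \<Rightarrow> 'a"
  where "L_op op a b = op a b"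

definition R_op :: "('a \<Rightarrow> 'a \<Rightarrow> 'a) \<Rightarrow> 'a \<Rightarrow> 'a \<Rightarrow> 'a"
  where "R_op op a b = op b a"

definition dual_rep :: "('a \<Rightarrow> 'v \<Rightarrow> 'v) \<Rightarrow> 'a \<Rightarrow> ('v \<Rightarrow> 'k::field) \<Rightarrow> 'v \<Rightarrow> 'k"
  where "dual_rep \<phi> a f = (\<lambda>v. - f (\<phi> a v))"

(* Sums and negatives of maps into End are the pointwise ones of Function_Algebras.  That the two
   tuples compared here are modules is proved below (regular_module, coregular_module). *)
definition frobenius_jnp ::
  "('k::field \<Rightarrow> 'a::ab_group_add \<Rightarrow> 'a) \<Rightarrow> ('a \<Rightarrow> 'a \<Rightarrow> 'a) \<Rightarrow> 'a \<Rightarrow> ('a \<Rightarrow> 'a \<Rightarrow> 'a) \<Rightarrow> bool"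
  where "frobenius_jnp s mult one circ \<longleftrightarrow>
    jacobi_novikov_poisson s mult one circ \<and> finite_dimensional s \<and>
    jnp_modules_isomorphic
      s UNIV (L_op circ) (R_op circ) (L_op mult)
      fun_scale (dual s) (dual_rep (L_op circ) + dual_rep (R_op circ))
        (- dual_rep (R_op circ)) (- dual_rep (L_op mult))"

definition quadratic_jnp ::
  "('k::field \<Rightarrow> 'a::ab_group_add \<Rightarrow> 'a) \<Rightarrow> ('a \<Rightarrow> 'a \<Rightarrow> 'a) \<Rightarrow> 'a \<Rightarrow> ('a \<Rightarrow> 'a \<Rightarrow> 'a) \<Rightarrow>
   ('a \<Rightarrow> 'a \<Rightarrow> 'k) \<Rightarrow> bool"
  where "quadratic_jnp s mult one circ B \<longleftrightarrow>
    jacobi_novikov_poisson s mult one circ \<and>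
    bilinear_map s s (*) B \<and>
    (\<forall>a b. B a b = B b a) \<and>
    (\<forall>a. (\<forall>b. B a b = 0) \<longrightarrow> a = 0) \<and>
    (\<forall>a b c. B (mult a b) c = B a (mult b c)) \<and>
    (\<forall>a b c. B (circ a b) c = - B b (circ a c + circ c a))"

definition is_integral ::
  "('k::field \<Rightarrow> 'a::ab_group_add \<Rightarrow> 'a) \<Rightarrow> ('a \<Rightarrow> 'a \<Rightarrow> 'a) \<Rightarrow> ('a \<Rightarrow> 'a \<Rightarrow> 'a) \<Rightarrow> ('a \<Rightarrow> 'k) \<Rightarrow> bool"
  where "is_integral s mult circ v \<longleftrightarrow>
    v \<in> dual s \<and>
    (\<forall>a b c. v (mult (circ a b) c) = - v (mult b (circ a c + circ c a)))"

definition nondegenerate_integral ::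
  "('k::field \<Rightarrow> 'a::ab_group_add \<Rightarrow> 'a) \<Rightarrow> ('a \<Rightarrow> 'a \<Rightarrow> 'a) \<Rightarrow> ('a \<Rightarrow> 'a \<Rightarrow> 'a) \<Rightarrow> ('a \<Rightarrow> 'k) \<Rightarrow> bool"
  where "nondegenerate_integral s mult circ v \<longleftrightarrow>
    is_integral s mult circ v \<and> (\<forall>a. (\<forall>b. v (mult a b) = 0) \<longrightarrow> a = 0)"


(* The tensor square of A is the quotient of the free vector space on pairs, i.e. the finitely
   supported functions from 'a * 'a to 'k, by the span of the bilinearity relations. *)

definition free_scale :: "'k::field \<Rightarrow> ('x \<Rightarrow>\<^sub>0 'k) \<Rightarrow> ('x \<Rightarrow>\<^sub>0 'k)"
  where "free_scale c = Poly_Mapping.map ((*) c)"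

abbreviation (input) free_pair :: "'a \<Rightarrow> 'a \<Rightarrow> ('a \<times> 'a) \<Rightarrow>\<^sub>0 'k::field"
  where "free_pair x y \<equiv> Poly_Mapping.single (x, y) 1"

definition tensor_relations ::
  "('k::field \<Rightarrow> 'a::ab_group_add \<Rightarrow> 'a) \<Rightarrow> (('a \<times> 'a) \<Rightarrow>\<^sub>0 'k) set"
  where "tensor_relations s =
      {free_pair (x + x') y - free_pair x y - free_pair x' y |x x' y. True}
    \<union> {free_pair x (y + y') - free_pair x y - free_pair x y' |x y y'. True}
    \<union> {free_pair (s c x) y - free_scale c (free_pair x y) |c x y. True}
    \<union> {free_pair x (s c y) - free_scale c (free_pair x y) |c x y. True}"

definition tensor_class ::
  "('k::field \<Rightarrow> 'a::ab_group_add \<Rightarrow> 'a) \<Rightarrow> (('a \<times> 'a) \<Rightarrow>\<^sub>0 'k) \<Rightarrow> (('a \<times> 'a) \<Rightarrow>\<^sub>0 'k) set"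
  where "tensor_class s u = {w. w - u \<in> module.span free_scale (tensor_relations s)}"

definition tensor_square ::
  "('k::field \<Rightarrow> 'a::ab_group_add \<Rightarrow> 'a) \<Rightarrow> (('a \<times> 'a) \<Rightarrow>\<^sub>0 'k) set set"
  where "tensor_square s = range (tensor_class s)"

(* the element of the tensor square written as the sum of x \<otimes> y over the list entries (x, y) *)
definition tensor_sum ::
  "('k::field \<Rightarrow> 'a::ab_group_add \<Rightarrow> 'a) \<Rightarrow> ('a \<times> 'a) list \<Rightarrow> (('a \<times> 'a) \<Rightarrow>\<^sub>0 'k) set"
  where "tensor_sum s es = tensor_class s (\<Sum>(x, y)\<leftarrow>es. free_pair x y)"

(* Sweedler notation: every presentation of e by a list of pairs gives the same conditions, see
   tensor_square_presentation, tensor_sum_map and tensor_sum_contract below. *)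
definition casimir_pair ::
  "('k::field \<Rightarrow> 'a::ab_group_add \<Rightarrow> 'a) \<Rightarrow> ('a \<Rightarrow> 'a \<Rightarrow> 'a) \<Rightarrow> 'a \<Rightarrow> ('a \<Rightarrow> 'k) \<Rightarrow>
   (('a \<times> 'a) \<Rightarrow>\<^sub>0 'k) set \<Rightarrow> bool"
  where "casimir_pair s mult one v e \<longleftrightarrow>
    (\<exists>es. e = tensor_sum s es \<and>
      (\<forall>a. tensor_sum s (map (\<lambda>(x, y). (mult a x, y)) es)
          = tensor_sum s (map (\<lambda>(x, y). (x, mult y a)) es)) \<and>
      (\<Sum>(x, y)\<leftarrow>es. s (v x) y) = one \<and>
      (\<Sum>(x, y)\<leftarrow>es. s (v y) x) = one)"


lemma fun_scale_vector_space: "vector_space (fun_scale :: 'k::field \<Rightarrow> ('a \<Rightarrow> 'k) \<Rightarrow> 'a \<Rightarrow> 'k)"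
  by unfold_locales (auto simp: fun_scale_def fun_eq_iff algebra_simps)

lemma lookup_free_scale: "Poly_Mapping.lookup (free_scale c u) x = c * Poly_Mapping.lookup u x"
  by (simp add: free_scale_def Poly_Mapping.map.rep_eq when_def)

lemma free_scale_vector_space: "vector_space (free_scale :: 'k::field \<Rightarrow> ('x \<Rightarrow>\<^sub>0 'k) \<Rightarrow> 'x \<Rightarrow>\<^sub>0 'k)"
  by unfold_locales
    (auto simp: poly_mapping_eq_iff fun_eq_iff lookup_add algebra_simps lookup_free_scale)

lemma bilinear_mapD:
  assumes "bilinear_map s1 s2 s3 f"
  shows "f (x + y) z = f x z + f y z" "f x (y' + z') = f x y' + f x z'"
    "f (s1 c x) z = s3 c (f x z)" "f x (s2 c z) = s3 c (f x z)"
    "f (x - y) z = f x z - f y z" "f x (y' - z') = f x y' - f x z'"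
    "f (- x) z = - f x z" "f x (- z) = - f x z" "f 0 z = 0" "f x 0 = 0"
proof -
  have l: "Vector_Spaces.linear s2 s3 (f x)" "Vector_Spaces.linear s1 s3 (\<lambda>x. f x z)" for x z
    using assms by (auto simp: bilinear_map_def)
  interpret a: Vector_Spaces.linear s2 s3 "f x" by (rule l)
  interpret b: Vector_Spaces.linear s1 s3 "\<lambda>x. f x z" by (rule l)
  show "f (x + y) z = f x z + f y z" "f x (y' + z') = f x y' + f x z'"
    "f (s1 c x) z = s3 c (f x z)" "f x (s2 c z) = s3 c (f x z)"
    "f (x - y) z = f x z - f y z" "f x (y' - z') = f x y' - f x z'"
    "f (- x) z = - f x z" "f x (- z) = - f x z" "f 0 z = 0" "f x 0 = 0"
    by (rule b.add a.add b.scale a.scale b.diff a.diff b.neg a.neg b.zero a.zero)+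
qed

lemma dualD:
  assumes "f \<in> dual s"
  shows "f (x + y) = f x + f y" "f (s c x) = c * f x" "f (x - y) = f x - f y" "f (- x) = - f x"
    "f 0 = 0"
proof -
  interpret a: Vector_Spaces.linear s "(*)" f using assms by (simp add: dual_def)
  show "f (x + y) = f x + f y" "f (s c x) = c * f x" "f (x - y) = f x - f y" "f (- x) = - f x"
    "f 0 = 0"
    by (rule a.add a.scale a.diff a.neg a.zero)+
qed

lemma dualI:
  assumes "vector_space s" "\<And>x y. f (x + y) = f x + f y" "\<And>c x. f (s c x) = c * f x"
  shows "f \<in> dual s"
proof -
  interpret vector_space s by fact
  interpret k: vector_space "(*) :: 'a \<Rightarrow> 'a \<Rightarrow> 'a" by unfold_locales (auto simp: algebra_simps)
  show ?thesis unfolding dual_def using assms(2,3) by (auto intro!: Vector_Spaces.linear.intro module_hom.intro module_hom_axioms.intro vector_space_axioms module_axioms k.vector_space_axioms k.module_axioms)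
qed

context jacobi_novikov_poisson
begin

lemmas bil = bilinear_mapD[OF mult_bilinear] bilinear_mapD[OF circ_bilinear]

lemma regular_module:
  "jnp_module s mult one circ s UNIV (L_op circ) (R_op circ) (L_op mult)"
proof unfold_locales
  show "linear_to_End s s UNIV (L_op circ)" "linear_to_End s s UNIV (R_op circ)"
    "linear_to_End s s UNIV (L_op mult)"
    by (auto simp: linear_to_End_def linear_between_def L_op_def R_op_def bil)
next
  fix a b v
  show "L_op circ a (L_op circ b v) - L_op circ (circ a b) v =
        L_op circ b (L_op circ a v) - L_op circ (circ b a) v"
    using circ_left_symmetric[of a b v] unfolding L_op_def by (metis minus_diff_eq)
  show "L_op circ a (R_op circ b v) - R_op circ b (L_op circ a v) =
        R_op circ (circ a b) v - R_op circ b (R_op circ a v)"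
    using circ_left_symmetric[of a v b] unfolding L_op_def R_op_def by (metis minus_diff_eq)
  show "L_op circ (circ a b) v = R_op circ b (L_op circ a v)"
    "R_op circ a (R_op circ b v) = R_op circ b (R_op circ a v)"
    unfolding L_op_def R_op_def by (rule circ_right_commute)+
  show "R_op circ b (L_op mult a v) = L_op mult a (R_op circ b v)"
    "L_op circ (mult a b) v = L_op mult a (L_op circ b v)"
    unfolding L_op_def R_op_def by (rule circ_mult_left)+
  show "L_op mult (mult a b) v = L_op mult a (L_op mult b v)"
    "L_op mult one v = v" by (auto simp: L_op_def mult_assoc mult_one)
  show "L_op mult a (R_op circ b v) = L_op mult (circ a b) v"
    unfolding L_op_def R_op_def by (metis circ_mult_left mult_commute)
  show "L_op circ a (L_op mult b v) - L_op mult b (L_op circ a v) =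
        L_op mult (circ a b) v - L_op mult (circ a one) (L_op mult b v)"
    unfolding L_op_def R_op_def circ_mult_right mult_commute[of "circ a one"] by simp
  show "R_op circ (mult a b) v - L_op mult b (R_op circ a v) =
        L_op mult a (R_op circ b v) - L_op mult (mult a b) (R_op circ one v)"
    unfolding L_op_def R_op_def circ_mult_right mult_commute[of "circ v a" b] by simp
qed auto

lemma coregular_module:
  "jnp_module s mult one circ fun_scale (dual s)
     (dual_rep (L_op circ) + dual_rep (R_op circ)) (- dual_rep (R_op circ)) (- dual_rep (L_op mult))"
proof -
  interpret V: vector_space "fun_scale :: 'k \<Rightarrow> ('a \<Rightarrow> 'k) \<Rightarrow> 'a \<Rightarrow> 'k"
    by (rule fun_scale_vector_space)
  note d = linear_to_End_def linear_between_def L_op_def R_op_def dual_rep_def fun_scale_def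
    fun_eq_iff
  have lin: "linear_to_End s fun_scale (dual s) (- dual_rep (L_op mult))"
    "linear_to_End s fun_scale (dual s) (- dual_rep (R_op circ))"
    "linear_to_End s fun_scale (dual s) (dual_rep (L_op circ) + dual_rep (R_op circ))"
    by (auto simp: d bil dualD algebra_simps intro!: dualI vector_space_axioms)
  have ls: "circ a (circ b c) = circ (circ a b) c - circ (circ b a) c + circ b (circ a c)" for a b c
    using circ_left_symmetric[of a b c] by (simp add: algebra_simps)
  have cm: "mult a (circ v b) = mult (circ a b) v" for a v b
    by (metis circ_mult_left mult_commute)
  show ?thesis
  proof unfold_locales
    show "V.subspace (dual s)"
      by (auto simp: V.subspace_def fun_scale_def dualD algebra_simps intro!: dualI vector_space_axioms)
  next
    fix v :: "'a \<Rightarrow> 'k" and a b assume v: "v \<in> dual s"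
    note D = dualD[OF v]
    let ?l = "dual_rep (L_op circ) + dual_rep (R_op circ)"
    let ?r = "- dual_rep (R_op circ)"
    let ?s = "- dual_rep (L_op mult)"
    show "?l a (?l b v) - ?l (circ a b) v = ?l b (?l a v) - ?l (circ b a) v"
    proof
      fix x
      have "circ b (circ a x) + circ b (circ x a) + circ (circ a x) b + circ (circ x a) b
          + circ (circ a b) x + circ x (circ a b)
        = circ a (circ b x) + circ a (circ x b) + circ (circ b x) a + circ (circ x b) a
          + circ (circ b a) x + circ x (circ b a)"
        unfolding ls[of b a x] ls[of b x a] ls[of a x b] circ_right_commute[of x a b]
          circ_right_commute[of a b x] circ_right_commute[of b a x]
        by (simp add: algebra_simps)
      from arg_cong[OF this, of v]
      show "(?l a (?l b v) - ?l (circ a b) v) x = (?l b (?l a v) - ?l (circ b a) v) x"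
        by (simp add: d D algebra_simps)
    qed
    show "?l a (?r b v) - ?r b (?l a v) = ?r (circ a b) v - ?r b (?r a v)"
    proof
      fix x
      show "(?l a (?r b v) - ?r b (?l a v)) x = (?r (circ a b) v - ?r b (?r a v)) x"
        using arg_cong[OF ls[of a x b], of v] arg_cong[OF circ_right_commute[of x a b], of v]
        by (simp add: d D algebra_simps)
    qed
    show "?l (circ a b) v = ?r b (?l a v)"
    proof
      fix x
      show "?l (circ a b) v x = ?r b (?l a v) x"
        using arg_cong[OF ls[of a x b], of v] arg_cong[OF circ_right_commute[of x a b], of v]
          arg_cong[OF circ_right_commute[of a b x], of v]
        by (simp add: d D algebra_simps)
    qed
    show "?r a (?r b v) = ?r b (?r a v)"
      using circ_right_commute by (simp add: d D)
    show "?s (mult a b) v = ?s a (?s b v)" "?s one v = v"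
      by (simp_all add: d D mult_one) (metis mult_assoc mult_commute)
    show "?r b (?s a v) = ?s a (?r b v)" by (simp add: d circ_mult_left)
    show "?s a (?r b v) = ?s (circ a b) v" by (simp add: d circ_mult_left cm)
    show "?l (mult a b) v = ?s a (?l b v)"
    proof
      fix x
      have "mult (circ x a) b = mult (circ b a) x"
        by (metis circ_mult_left mult_commute)
      moreover have "mult (mult a b) (circ x one) = mult (mult a x) (circ b one)"
        by (metis circ_mult_left mult_commute mult_assoc)
      ultimately have "circ (mult a b) x + circ x (mult a b) = circ b (mult a x) + circ (mult a x) b"
        by (simp add: circ_mult_right circ_mult_left algebra_simps)
      from arg_cong[OF this, of v]
      show "?l (mult a b) v x = ?s a (?l b v) x" by (simp add: d D algebra_simps)
    qed
    show "?l a (?s b v) - ?s b (?l a v) = ?s (circ a b) v - ?s (circ a one) (?s b v)"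
    proof
      fix x
      have "circ a (mult b x) + mult b (mult (circ a one) x) = mult b (circ a x) + mult (circ a b) x"
        by (simp add: circ_mult_right mult_assoc mult_commute[of x "circ a one"])
      from arg_cong[OF this, of v]
      show "(?l a (?s b v) - ?s b (?l a v)) x = (?s (circ a b) v - ?s (circ a one) (?s b v)) x"
        by (simp add: d D circ_mult_left algebra_simps)
    qed
    show "?r (mult a b) v - ?s b (?r a v) = ?s a (?r b v) - ?s (mult a b) (?r one v)"
    proof
      fix x
      have "circ x (mult a b) + circ (mult (mult a b) x) one = circ (mult b x) a + circ (mult a x) b"
        by (simp add: circ_mult_right circ_mult_left mult_commute[of "circ x a" b])
      from arg_cong[OF this, of v]
      show "(?r (mult a b) v - ?s b (?r a v)) x = (?s a (?r b v) - ?s (mult a b) (?r one v)) x"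
        by (simp add: d D algebra_simps)
    qed
  qed (rule lin)+
qed

end

lemma tensor_class_eq_iff:
  fixes s :: "'k::field \<Rightarrow> 'a::ab_group_add \<Rightarrow> 'a"
  shows "tensor_class s u = tensor_class s w \<longleftrightarrow> u - w \<in> module.span free_scale (tensor_relations s)"
proof -
  interpret F: vector_space "free_scale :: 'k \<Rightarrow> (('a \<times> 'a) \<Rightarrow>\<^sub>0 'k) \<Rightarrow> _"
    by (rule free_scale_vector_space)
  have "u \<in> tensor_class s u" by (simp add: tensor_class_def F.span_zero)
  moreover have "x - w \<in> F.span R" if "x - u \<in> F.span R" "u - w \<in> F.span R" for x u w R
    using F.span_add[OF that] by simp
  moreover have "w - u \<in> F.span R" if "u - w \<in> F.span R" for u w R
    using F.span_neg[OF that] by simp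
  ultimately show ?thesis unfolding tensor_class_def by blast
qed

lemma tensor_relationsI:
  "free_pair (x + x') y - free_pair x y - free_pair x' y \<in> tensor_relations s"
  "free_pair x (y + y') - free_pair x y - free_pair x y' \<in> tensor_relations s"
  "free_pair (s c x) y - free_scale c (free_pair x y) \<in> tensor_relations s"
  "free_pair x (s c y) - free_scale c (free_pair x y) \<in> tensor_relations s"
  unfolding tensor_relations_def by blast+

lemma tensor_relationsE:
  assumes "r \<in> tensor_relations s"
  obtains x x' y where "r = free_pair (x + x') y - free_pair x y - free_pair x' y"
  | x y y' where "r = free_pair x (y + y') - free_pair x y - free_pair x y'"
  | c x y where "r = free_pair (s c x) y - free_scale c (free_pair x y)"
  | c x y where "r = free_pair x (s c y) - free_scale c (free_pair x y)"
  using assms unfolding tensor_relations_def by blast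

(* a linear map on the free space that kills the relations factors through the tensor square *)
definition free_extend :: "('k::field \<Rightarrow> 'c::ab_group_add \<Rightarrow> 'c) \<Rightarrow> ('x \<Rightarrow> 'c) \<Rightarrow> ('x \<Rightarrow>\<^sub>0 'k) \<Rightarrow> 'c"
  where "free_extend sC f u = (\<Sum>x\<in>Poly_Mapping.keys u. sC (Poly_Mapping.lookup u x) (f x))"

lemma free_extend_linear:
  assumes "vector_space sC"
  shows "free_extend sC f (u + w) = free_extend sC f u + free_extend sC f w"
    "free_extend sC f (free_scale c u) = sC c (free_extend sC f u)"
    "free_extend sC f (Poly_Mapping.single x c) = sC c (f x)"
    "free_extend sC f 0 = 0"
proof -
  interpret C: vector_space sC by fact
  have sup: "free_extend sC f u = (\<Sum>x\<in>S. sC (Poly_Mapping.lookup u x) (f x))" if "finite S" "Poly_Mapping.keys u \<subseteq> S" for u S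
    unfolding free_extend_def by (rule sum.mono_neutral_left) (use that in \<open>auto simp: in_keys_iff\<close>)
  show "free_extend sC f (u + w) = free_extend sC f u + free_extend sC f w"
    using sup[of "Poly_Mapping.keys u \<union> Poly_Mapping.keys w" u] sup[of "Poly_Mapping.keys u \<union> Poly_Mapping.keys w" w] sup[of "Poly_Mapping.keys u \<union> Poly_Mapping.keys w" "u + w"]
      keys_add[of u w]
    by (simp add: lookup_add C.scale_left_distrib sum.distrib)
  show "free_extend sC f (free_scale c u) = sC c (free_extend sC f u)"
    using sup[of "Poly_Mapping.keys u" "free_scale c u"]
    by (auto simp: free_extend_def C.scale_sum_right in_keys_iff subset_iff lookup_free_scale)
  show "free_extend sC f (Poly_Mapping.single x c) = sC c (f x)" "free_extend sC f 0 = 0"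
    by (simp_all add: free_extend_def)
qed

lemma free_extend_diff:
  assumes "vector_space sC"
  shows "free_extend sC f (u - w) = free_extend sC f u - free_extend sC f w"
  using free_extend_linear(1)[OF assms, of f "u - w" w] by simp

lemma free_extend_sum_list:
  assumes "vector_space sC"
  shows "free_extend sC f (\<Sum>(x, y)\<leftarrow>es. free_pair x y) = (\<Sum>(x, y)\<leftarrow>es. f (x, y))"
proof -
  interpret C: vector_space sC by fact
  show ?thesis by (induction es) (auto simp: free_extend_linear[OF assms])
qed

lemma free_extend_span:
  assumes "vector_space sC" "module.subspace sC N" "\<And>r. r \<in> R \<Longrightarrow> free_extend sC f r \<in> N"
    and "u \<in> module.span free_scale R"
  shows "free_extend sC f u \<in> N"
proof -
  interpret C: vector_space sC by fact
  interpret F: vector_space "free_scale :: 'a \<Rightarrow> ('c \<Rightarrow>\<^sub>0 'a) \<Rightarrow> _" by (rule free_scale_vector_space)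
  have "F.subspace {u. free_extend sC f u \<in> N}"
    using assms(2) by (auto simp: F.subspace_def C.subspace_def free_extend_linear[OF assms(1)])
  from F.span_induct[OF assms(4) this] assms(3) show ?thesis by simp
qed

lemma tensor_square_presentation:
  assumes "vector_space s" "e \<in> tensor_square s"
  shows "\<exists>es. e = tensor_sum s es"
proof -
  interpret vector_space s by fact
  interpret F: vector_space "free_scale :: 'a \<Rightarrow> (('b \<times> 'b) \<Rightarrow>\<^sub>0 'a) \<Rightarrow> _"
    by (rule free_scale_vector_space)
  have single: "Poly_Mapping.single (x, y) c = free_scale c (free_pair x y)" for x y :: 'b and c :: 'a
    by (auto simp: poly_mapping_eq_iff fun_eq_iff lookup_single lookup_free_scale when_def)
  have "\<exists>es. u - (\<Sum>(x, y)\<leftarrow>es. free_pair x y) \<in> F.span (tensor_relations s)" for u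
  proof (induction u rule: update_induct)
    case const
    show ?case by (intro exI[of _ "[]"]) (simp add: F.span_zero)
  next
    case (update f p c)
    then obtain es where es: "f - (\<Sum>(x, y)\<leftarrow>es. free_pair x y) \<in> F.span (tensor_relations s)"
      by blast
    obtain x y where p: "p = (x, y)" by (cases p)
    have "Poly_Mapping.update p c f = f + Poly_Mapping.single p c"
      using update(1) by (auto simp: poly_mapping_eq_iff fun_eq_iff lookup_update lookup_add
          lookup_single in_keys_iff when_def)
    then have upd: "Poly_Mapping.update p c f = f + free_scale c (free_pair x y)"
      by (simp only: p single[of x y c])
    have "free_pair (s c x) y - free_scale c (free_pair x y) \<in> F.span (tensor_relations s)"
      by (rule F.span_base) (rule tensor_relationsI)
    from F.span_diff[OF es this] show ?case
      unfolding upd by (intro exI[of _ "(s c x, y) # es"]) (simp add: algebra_simps case_prod_unfold)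
  qed
  then show ?thesis using assms(2)
    by (auto simp: tensor_square_def tensor_sum_def tensor_class_eq_iff)
qed

lemma tensor_sum_map:
  assumes "Vector_Spaces.linear s s f" "Vector_Spaces.linear s s g"
    and "tensor_sum s es = tensor_sum s es'"
  shows "tensor_sum s (map (\<lambda>(x, y). (f x, g y)) es) = tensor_sum s (map (\<lambda>(x, y). (f x, g y)) es')"
proof -
  interpret f: Vector_Spaces.linear s s f by fact
  interpret g: Vector_Spaces.linear s s g by fact
  interpret F: vector_space "free_scale :: 'a \<Rightarrow> (('b \<times> 'b) \<Rightarrow>\<^sub>0 'a) \<Rightarrow> _"
    by (rule free_scale_vector_space)
  note vs = F.vector_space_axioms
  let ?h = "\<lambda>(x, y). free_pair (f x) (g y) :: ('b \<times> 'b) \<Rightarrow>\<^sub>0 'a"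
  have map_case: "(\<Sum>(x, y)\<leftarrow>map (\<lambda>(x, y). (f x, g y)) es. free_pair x y) = (\<Sum>(x, y)\<leftarrow>es. ?h (x, y))"
    for es by (induction es) auto
  let ?N = "F.span (tensor_relations s)"
  have rel: "free_extend free_scale ?h r \<in> ?N" if "r \<in> tensor_relations s" for r
    using that
    by (intro F.span_base, elim tensor_relationsE; hypsubst)
      (simp_all add: free_extend_linear[OF vs] free_extend_diff[OF vs]
        f.add g.add f.scale g.scale tensor_relationsI)
  have "(\<Sum>(x, y)\<leftarrow>es. free_pair x y) - (\<Sum>(x, y)\<leftarrow>es'. free_pair x y) \<in> ?N"
    using assms(3) by (simp add: tensor_sum_def tensor_class_eq_iff)
  from free_extend_span[OF vs F.subspace_span rel this]
  show ?thesis
    unfolding tensor_sum_def tensor_class_eq_iff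
    by (simp add: free_extend_diff[OF vs] free_extend_sum_list[OF vs] map_case del: map_map)
qed

lemma tensor_sum_contract:
  assumes "vector_space s" "v \<in> dual s" and "tensor_sum s es = tensor_sum s es'"
  shows "(\<Sum>(x, y)\<leftarrow>es. s (v x) y) = (\<Sum>(x, y)\<leftarrow>es'. s (v x) y)"
    "(\<Sum>(x, y)\<leftarrow>es. s (v y) x) = (\<Sum>(x, y)\<leftarrow>es'. s (v y) x)"
proof -
  interpret vector_space s by fact
  note vs = assms(1)
  note D = dualD[OF assms(2)]
  have e: "(\<Sum>(x, y)\<leftarrow>es. free_pair x y) - (\<Sum>(x, y)\<leftarrow>es'. free_pair x y)
      \<in> module.span free_scale (tensor_relations s)"
    using assms(3) by (simp add: tensor_sum_def tensor_class_eq_iff)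
  have "free_extend s (\<lambda>(x, y). s (v x) y) r \<in> {0}" "free_extend s (\<lambda>(x, y). s (v y) x) r \<in> {0}"
    if "r \<in> tensor_relations s" for r
    using that
    by (elim tensor_relationsE; hypsubst;
        simp add: free_extend_linear[OF vs] free_extend_diff[OF vs] D algebra_simps)+
  note this[THEN free_extend_span[OF vs subspace_single_0 _ e]]
  then show "(\<Sum>(x, y)\<leftarrow>es. s (v x) y) = (\<Sum>(x, y)\<leftarrow>es'. s (v x) y)"
    "(\<Sum>(x, y)\<leftarrow>es. s (v y) x) = (\<Sum>(x, y)\<leftarrow>es'. s (v y) x)"
    by (simp_all add: free_extend_diff[OF vs] free_extend_sum_list[OF vs])
qed

end

theory Submission
  imports Defs
begin

text \<open>
  All four conditions describe one object.  A symmetric form for which multiplication by every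
  element is self-adjoint is determined by the functional \<open>v = \<B>(1, _)\<close>, through
  \<open>\<B>(a, b) = v (a \<cdot> b)\<close>, and under this correspondence the remaining axiom of a quadratic structure
  becomes the integral identity.  Likewise a homomorphism \<open>f\<close> of \<open>\<cdot>\<close>-modules from \<open>A\<close> to its dual is
  determined by \<open>v = f 1\<close>, since \<open>f a b = f 1 (a \<cdot> b)\<close>; commuting with the left actions is then the
  integral identity, and commuting with the right actions follows from it by symmetry.  Injectivity
  of \<open>f\<close>, nondegeneracy of \<open>\<B>\<close> and nondegeneracy of \<open>v\<close> are the same condition, and finite
  dimension makes the injective map \<open>a \<mapsto> \<B>(a, _)\<close> onto (\<open>represents_functional\<close>).

  For condition (d), a nondegenerate form has dual bases \<open>b\<^sub>i\<close>, \<open>d\<^sub>i\<close>, and \<open>e = \<Sum> b\<^sub>i \<otimes> d\<^sub>i\<close> is the tensor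
  that corresponds to the identity map under \<open>A \<otimes> A \<cong> A \<otimes> A\<^sup>* \<cong> End A\<close>.  A self-adjoint map can
  be moved from one factor of \<open>e\<close> to the other (\<open>casimir_self_adjoint\<close>), and contracting \<open>e\<close> with \<open>v\<close>
  expands \<open>1\<close> in one of the two bases.  Conversely, applying \<open>v\<close> to the second factor of
  \<open>\<Sum> a \<cdot> e\<^sup>1 \<otimes> e\<^sup>2 = \<Sum> e\<^sup>1 \<otimes> e\<^sup>2 \<cdot> a\<close> gives \<open>a = \<Sum> v (e\<^sup>2 \<cdot> a) e\<^sup>1\<close>, so \<open>a\<close> vanishes as soon as
  \<open>v\<close> vanishes on \<open>a \<cdot> A\<close>.
\<close>

section \<open>Sums in the tensor square\<close>

lemma free_pair_scaled_sum:
  fixes s :: "'k::field \<Rightarrow> 'a::ab_group_add \<Rightarrow> 'a"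
  assumes "vector_space s" "finite J"
  shows "free_pair (\<Sum>j\<in>J. s (c j) (b j)) y - (\<Sum>j\<in>J. free_scale (c j) (free_pair (b j) y))
      \<in> module.span free_scale (tensor_relations s)" (is "?left J")
    and "free_pair x (\<Sum>j\<in>J. s (c j) (b j)) - (\<Sum>j\<in>J. free_scale (c j) (free_pair x (b j)))
      \<in> module.span free_scale (tensor_relations s)" (is "?right J")
proof -
  interpret vector_space s by fact
  interpret F: vector_space "free_scale :: 'k \<Rightarrow> (('a \<times> 'a) \<Rightarrow>\<^sub>0 'k) \<Rightarrow> _"
    by (rule free_scale_vector_space)
  have zero: "free_pair 0 y \<in> F.span (tensor_relations s)" "free_pair x 0 \<in> F.span (tensor_relations s)"
    for x y
    using F.span_neg[OF F.span_base[OF tensor_relationsI(1)[of 0 0 y s]]]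
      F.span_neg[OF F.span_base[OF tensor_relationsI(2)[of x 0 0 s]]] by simp_all
  show "?left J" using assms(2)
  proof (induction J rule: finite_induct)
    case empty
    show ?case using zero by simp
  next
    case (insert j J)
    from F.span_add[OF F.span_add[OF insert.IH F.span_base[OF tensor_relationsI(3)[of s "c j" "b j" y]]]
        F.span_base[OF tensor_relationsI(1)[of "s (c j) (b j)" "\<Sum>j\<in>J. s (c j) (b j)" y s]]]
    show ?case using insert.hyps by (simp add: algebra_simps)
  qed
  show "?right J" using assms(2)
  proof (induction J rule: finite_induct)
    case empty
    show ?case using zero by simp
  next
    case (insert j J)
    from F.span_add[OF F.span_add[OF insert.IH F.span_base[OF tensor_relationsI(4)[of x s "c j" "b j"]]]
        F.span_base[OF tensor_relationsI(2)[of x "s (c j) (b j)" "\<Sum>j\<in>J. s (c j) (b j)" s]]]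
    show ?case using insert.hyps by (simp add: algebra_simps)
  qed
qed

text \<open>Two tensors agree when a single matrix \<open>c\<close> expresses the first factors of one and the second
  factors of the other: both are then the double sum of \<open>c i j (b j \<otimes> d i)\<close>.\<close>

lemma tensor_sum_transpose:
  fixes s :: "'k::field \<Rightarrow> 'a::ab_group_add \<Rightarrow> 'a"
  assumes "vector_space s" "distinct bs"
    and f: "\<And>i. i \<in> set bs \<Longrightarrow> f i = (\<Sum>j\<in>set bs. s (c i j) (b j))"
    and g: "\<And>j. j \<in> set bs \<Longrightarrow> g j = (\<Sum>i\<in>set bs. s (c i j) (d i))"
  shows "tensor_sum s (map (\<lambda>i. (f i, d i)) bs) = tensor_sum s (map (\<lambda>j. (b j, g j)) bs)"
proof -
  interpret vector_space s by fact
  interpret F: vector_space "free_scale :: 'k \<Rightarrow> (('a \<times> 'a) \<Rightarrow>\<^sub>0 'k) \<Rightarrow> _"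
    by (rule free_scale_vector_space)
  let ?N = "F.span (tensor_relations s)"
  let ?D = "\<Sum>i\<in>set bs. \<Sum>j\<in>set bs. free_scale (c i j) (free_pair (b j) (d i))"
  have "(\<Sum>i\<in>set bs. free_pair (f i) (d i)
      - (\<Sum>j\<in>set bs. free_scale (c i j) (free_pair (b j) (d i)))) \<in> ?N"
    by (intro F.span_sum) (simp add: f free_pair_scaled_sum(1)[OF assms(1)])
  then have 1: "(\<Sum>i\<in>set bs. free_pair (f i) (d i)) - ?D \<in> ?N"
    by (simp add: sum_subtractf)
  have "(\<Sum>j\<in>set bs. free_pair (b j) (g j)
      - (\<Sum>i\<in>set bs. free_scale (c i j) (free_pair (b j) (d i)))) \<in> ?N"
    by (intro F.span_sum) (simp add: g free_pair_scaled_sum(2)[OF assms(1)])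
  moreover have "?D = (\<Sum>j\<in>set bs. \<Sum>i\<in>set bs. free_scale (c i j) (free_pair (b j) (d i)))"
    by (rule sum.swap)
  ultimately have 2: "(\<Sum>j\<in>set bs. free_pair (b j) (g j)) - ?D \<in> ?N"
    by (simp only: sum_subtractf)
  from F.span_diff[OF 1 2] show ?thesis
    by (simp add: tensor_sum_def tensor_class_eq_iff o_def sum_list_distinct_conv_sum_set assms(2))
qed

section \<open>Nondegenerate symmetric forms and dual bases\<close>

locale nondegenerate_symmetric_form = finite_dimensional_vector_space s Basis
  for s :: "'k::field \<Rightarrow> 'a::ab_group_add \<Rightarrow> 'a" and Basis :: "'a set" +
  fixes B :: "'a \<Rightarrow> 'a \<Rightarrow> 'k"
  assumes form_bilinear: "bilinear_map s s (*) B"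
    and form_symmetric: "B x y = B y x"
    and form_nondegenerate: "(\<And>y. B x y = 0) \<Longrightarrow> x = 0"
begin

lemmas form_bil = bilinear_mapD[OF form_bilinear]

lemma form_sum: "B (\<Sum>i\<in>I. s (c i) (x i)) y = (\<Sum>i\<in>I. c i * B (x i) y)"
proof -
  interpret Vector_Spaces.linear s "(*)" "\<lambda>x. B x y"
    using form_bilinear by (simp add: bilinear_map_def)
  show ?thesis by (simp add: sum scale)
qed

lemma form_in_dual: "B x \<in> dual s"
  using form_bilinear by (simp add: bilinear_map_def dual_def)

lemma form_eqI:
  assumes "\<And>z. B x z = B y z"
  shows "x = y"
  using form_nondegenerate[of "x - y"] assms by (simp add: form_bil)

lemma sum_representation_Basis: "(\<Sum>b\<in>Basis. s (representation Basis x b) b) = x"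
  by (rule sum_representation_eq)
    (use independent_Basis span_Basis finite_Basis in auto)

lemma dual_eqI:
  assumes "f \<in> dual s" "g \<in> dual s" "\<And>b. b \<in> Basis \<Longrightarrow> f b = g b"
  shows "f = g"
proof
  fix x
  interpret f: Vector_Spaces.linear s "(*)" f using assms(1) by (simp add: dual_def)
  interpret g: Vector_Spaces.linear s "(*)" g using assms(2) by (simp add: dual_def)
  have "f (\<Sum>b\<in>Basis. s (representation Basis x b) b)
      = g (\<Sum>b\<in>Basis. s (representation Basis x b) b)"
    by (simp add: f.sum f.scale g.sum g.scale assms(3))
  then show "f x = g x" by (simp add: sum_representation_Basis)
qed

text \<open>Nondegeneracy says that \<open>x \<mapsto> B x\<close> is injective.  To count dimensions inside \<open>A\<close> itself, the
  dual is identified with \<open>A\<close> by sending a functional to the vector whose coordinates are its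
  values on the basis.\<close>

lemma represents_functional:
  assumes "f \<in> dual s"
  obtains x where "B x = f"
proof -
  define g where "g x = (\<Sum>b\<in>Basis. s (B x b) b)" for x
  have lin: "Vector_Spaces.linear s s g"
    by (rule Vector_Spaces.linear.intro)
      (auto intro!: module_hom.intro module_hom_axioms.intro vector_space_axioms module_axioms
        simp: g_def form_bil scale_left_distrib sum.distrib scale_sum_right)
  have coords: "c b = c' b" if "(\<Sum>b\<in>Basis. s (c b) b) = (\<Sum>b\<in>Basis. s (c' b) b)" "b \<in> Basis"
    for c c' b
  proof -
    have "(\<Sum>b\<in>Basis. s (c b - c' b) b) = 0"
      using that(1) by (simp add: scale_left_diff_distrib sum_subtractf)
    from independentD[OF independent_Basis finite_Basis subset_refl this that(2)]
    have "c b - c' b = 0" .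
    then show ?thesis by simp
  qed
  have "inj g"
  proof (rule injI)
    fix x y assume "g x = g y"
    then have "B x b = B y b" if "b \<in> Basis" for b
      using coords[of "B x" "B y"] that by (simp add: g_def)
    then have "B x = B y" by (intro dual_eqI form_in_dual)
    then show "x = y" by (auto intro: form_eqI)
  qed
  with lin have "surj g" by (rule linear_inj_imp_surj)
  then obtain x where "g x = (\<Sum>b\<in>Basis. s (f b) b)" by (metis surjD)
  then have "B x b = f b" if "b \<in> Basis" for b
    using coords[of "B x" f] that by (simp add: g_def)
  then have "B x = f" by (intro dual_eqI form_in_dual assms)
  then show ?thesis by (rule that)
qed

definition dual_vector :: "'a \<Rightarrow> 'a"
  where "dual_vector b = (SOME d. \<forall>x. B d x = representation Basis x b)"

lemma form_dual_vector: "B (dual_vector b) x = representation Basis x b"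
proof -
  have "(\<lambda>x. representation Basis x b) \<in> dual s"
    by (rule dualI[OF vector_space_axioms])
      (simp_all add: representation_add representation_scale independent_Basis span_Basis)
  then obtain d where "B d = (\<lambda>x. representation Basis x b)" by (rule represents_functional)
  then have "\<exists>d. \<forall>x. B d x = representation Basis x b" by metis
  from someI_ex[OF this] show ?thesis by (simp add: dual_vector_def)
qed

lemma Basis_expansion: "(\<Sum>b\<in>Basis. s (B (dual_vector b) x) b) = x"
  by (simp add: form_dual_vector sum_representation_Basis)

text \<open>Pairing the sum with \<open>y\<close> is the same as pairing \<open>x\<close> with the expansion of \<open>y\<close> in \<open>Basis\<close>.\<close>

lemma dual_basis_expansion: "(\<Sum>b\<in>Basis. s (B b x) (dual_vector b)) = x"
proof (rule form_eqI)
  fix y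
  have "B (\<Sum>b\<in>Basis. s (B b x) (dual_vector b)) y = B (\<Sum>b\<in>Basis. s (B (dual_vector b) y) b) x"
    unfolding form_sum by (simp add: mult.commute)
  then show "B (\<Sum>b\<in>Basis. s (B b x) (dual_vector b)) y = B x y"
    by (simp only: Basis_expansion form_symmetric[of y x])
qed

text \<open>The matrix that expresses \<open>T b\<close> in \<open>Basis\<close> has entries \<open>B (dual_vector b') (T b)\<close>, and the
  one that expresses \<open>T (dual_vector b')\<close> in the dual basis has entries
  \<open>B b (T (dual_vector b'))\<close>; for self-adjoint \<open>T\<close> these are equal.\<close>

lemma casimir_self_adjoint:
  assumes "distinct bs" "set bs = Basis"
    and adj: "\<And>x y. B (T x) y = B x (T y)"
  shows "tensor_sum s (map (\<lambda>b. (T b, dual_vector b)) bs)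
    = tensor_sum s (map (\<lambda>b. (b, T (dual_vector b))) bs)"
proof (rule tensor_sum_transpose[OF vector_space_axioms assms(1),
      where c = "\<lambda>b b'. B (dual_vector b') (T b)"])
  show "T b = (\<Sum>b'\<in>set bs. s (B (dual_vector b') (T b)) b')" for b
    by (simp add: assms(2) Basis_expansion)
  have "B (dual_vector b') (T b) = B b (T (dual_vector b'))" for b b'
    by (metis adj form_symmetric)
  then show "T (dual_vector b') = (\<Sum>b\<in>set bs. s (B (dual_vector b') (T b)) (dual_vector b))" for b'
    by (simp add: assms(2) dual_basis_expansion)
qed

end

section \<open>Forms, integrals and Casimir elements\<close>

context jacobi_novikov_poisson
begin

lemma mult_one_right: "mult a one = a"
  by (metis mult_one mult_commute)

lemma quadratic_imp_nondegenerate_integral: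
  assumes "quadratic_jnp s mult one circ B"
  shows "nondegenerate_integral s mult circ (B one)"
proof -
  have inv: "B (mult a b) c = B a (mult b c)"
    and skew: "B (circ a b) c = - B b (circ a c + circ c a)"
    and nd: "(\<And>b. B a b = 0) \<Longrightarrow> a = 0" for a b c
    using assms by (auto simp: quadratic_jnp_def)
  have eq: "B one (mult a b) = B a b" for a b
    using inv[of one a b] by (simp add: mult_one)
  have "B one \<in> dual s"
    using assms by (auto simp: quadratic_jnp_def bilinear_map_def dual_def)
  then show ?thesis
    using nd by (auto simp: nondegenerate_integral_def is_integral_def eq skew)
qed

lemma integral_form_bilinear:
  assumes "v \<in> dual s"
  shows "bilinear_map s s (*) (\<lambda>a b. v (mult a b))"
proof -
  note D = dualD[OF assms]
  have "(\<lambda>b. v (mult a b)) \<in> dual s" "(\<lambda>a. v (mult a b)) \<in> dual s" for a b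
    by (rule dualI[OF vector_space_axioms]; simp add: bil D)+
  then show ?thesis by (simp add: bilinear_map_def dual_def)
qed

lemma nondegenerate_integral_imp_quadratic:
  assumes "nondegenerate_integral s mult circ v"
  shows "quadratic_jnp s mult one circ (\<lambda>a b. v (mult a b))"
  using assms integral_form_bilinear jacobi_novikov_poisson_axioms
  by (auto simp: quadratic_jnp_def nondegenerate_integral_def is_integral_def mult_assoc
      intro: arg_cong[of _ _ v, OF mult_commute])

lemma quadratic_form_locale:
  assumes "quadratic_jnp s mult one circ B" "finite_dimensional_vector_space s Basis"
  shows "nondegenerate_symmetric_form s Basis B"
  using assms by (auto simp: quadratic_jnp_def nondegenerate_symmetric_form_def
      nondegenerate_symmetric_form_axioms_def)

text \<open>The isomorphism is \<open>a \<mapsto> \<B>(a, _)\<close>.  Compatibility with the right actions,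
  \<open>\<B>(b \<circ> a, c) = \<B>(b, c \<circ> a)\<close>, holds because the other expression \<open>-\<B>(a, b \<circ> c + c \<circ> b)\<close> for
  the left-hand side is symmetric in \<open>b\<close> and \<open>c\<close>.\<close>

lemma quadratic_imp_frobenius:
  assumes "quadratic_jnp s mult one circ B" "finite_dimensional s"
  shows "frobenius_jnp s mult one circ"
proof -
  obtain Basis where "finite_dimensional_vector_space s Basis"
    using assms(2) by (auto simp: finite_dimensional_def)
  from quadratic_form_locale[OF assms(1) this]
  interpret form: nondegenerate_symmetric_form s Basis B .
  have inv: "B (mult a b) c = B a (mult b c)"
    and skew: "B (circ a b) c = - B b (circ a c + circ c a)" for a b c
    using assms(1) by (auto simp: quadratic_jnp_def)
  have right: "B (circ b a) c = B b (circ c a)" for a b c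
    by (metis skew add.commute form.form_symmetric)
  have left: "B (circ a b) c = - B b (circ a c) - B b (circ c a)" for a b c
    by (simp add: skew form.form_bil)
  have mul: "B (mult a b) c = B b (mult a c)" for a b c
    by (metis inv mult_commute)
  have "bij_betw B UNIV (dual s)"
    unfolding bij_betw_def
  proof
    show "inj B" by (rule injI) (simp add: form.form_eqI)
    show "range B = dual s"
    proof
      show "range B \<subseteq> dual s" by (auto simp: form.form_in_dual)
      show "dual s \<subseteq> range B" by (blast elim: form.represents_functional)
    qed
  qed
  moreover have "linear_between s UNIV fun_scale (dual s) B"
    by (auto simp: linear_between_def form.form_in_dual form.form_bil fun_scale_def fun_eq_iff)
  moreover have "B (L_op circ a b) = (dual_rep (L_op circ) + dual_rep (R_op circ)) a (B b)" for a b
    by (simp add: fun_eq_iff L_op_def R_op_def dual_rep_def left)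
  moreover have "B (R_op circ a b) = (- dual_rep (R_op circ)) a (B b)"
    "B (L_op mult a b) = (- dual_rep (L_op mult)) a (B b)" for a b
    by (simp_all add: fun_eq_iff L_op_def R_op_def dual_rep_def right mul)
  ultimately show ?thesis
    using assms(2) jacobi_novikov_poisson_axioms
    unfolding frobenius_jnp_def jnp_modules_isomorphic_def by blast
qed

lemma frobenius_imp_nondegenerate_integral:
  assumes "frobenius_jnp s mult one circ"
  shows "\<exists>v. nondegenerate_integral s mult circ v"
proof -
  obtain f where lin: "linear_between s UNIV fun_scale (dual s) f"
    and bij: "bij_betw f UNIV (dual s)"
    and hom: "f (L_op circ a b) = (dual_rep (L_op circ) + dual_rep (R_op circ)) a (f b)"
      "f (L_op mult a b) = (- dual_rep (L_op mult)) a (f b)" for a b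
    using assms unfolding frobenius_jnp_def jnp_modules_isomorphic_def by blast
  have dual: "f a \<in> dual s" for a
    using lin by (auto simp: linear_between_def)
  have eq: "f one (mult a b) = f a b" for a b
    using fun_cong[OF hom(2)[of a one], of b] by (simp add: L_op_def dual_rep_def mult_one_right)
  have "f (circ a b) c = - f b (circ a c + circ c a)" for a b c
    using fun_cong[OF hom(1)[of a b], of c]
    by (simp add: L_op_def R_op_def dual_rep_def dualD[OF dual])
  moreover have "a = 0" if "\<And>b. f a b = 0" for a
  proof -
    have "f (0 + 0) = f 0 + f 0" using lin by (simp only: linear_between_def) blast
    then have "f 0 = 0" by (metis add_cancel_right_right)
    moreover have "f a = 0" using that by (simp add: fun_eq_iff)
    ultimately have "f a = f 0" by simp
    then show ?thesis using bij by (simp add: bij_betw_def inj_eq)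
  qed
  ultimately have "nondegenerate_integral s mult circ (f one)"
    by (auto simp: nondegenerate_integral_def is_integral_def dual eq)
  then show ?thesis by blast
qed

lemma nondegenerate_integral_imp_casimir_pair:
  assumes "nondegenerate_integral s mult circ v" "finite_dimensional s"
  shows "\<exists>e\<in>tensor_square s. casimir_pair s mult one v e"
proof -
  obtain Basis where "finite_dimensional_vector_space s Basis"
    using assms(2) by (auto simp: finite_dimensional_def)
  from quadratic_form_locale[OF nondegenerate_integral_imp_quadratic[OF assms(1)] this]
  interpret form: nondegenerate_symmetric_form s Basis "\<lambda>a b. v (mult a b)" .
  let ?d = "form.dual_vector"
  obtain bs where bs: "distinct bs" "set bs = Basis"
    using finite_distinct_list[OF form.finite_Basis] by blast
  let ?es = "map (\<lambda>b. (b, ?d b)) bs"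
  have "tensor_sum s (map (\<lambda>(x, y). (mult a x, y)) ?es)
      = tensor_sum s (map (\<lambda>(x, y). (x, mult y a)) ?es)" for a
    using form.casimir_self_adjoint[OF bs, of "mult a"]
    by (simp add: o_def mult_commute[of _ a] mult_assoc[symmetric])
  moreover have "(\<Sum>(x, y)\<leftarrow>?es. s (v x) y) = one"
    using form.dual_basis_expansion[of one]
    by (simp add: o_def sum_list_distinct_conv_sum_set bs mult_one_right)
  moreover have "(\<Sum>(x, y)\<leftarrow>?es. s (v y) x) = one"
    using form.Basis_expansion[of one]
    by (simp add: o_def sum_list_distinct_conv_sum_set bs mult_one_right)
  ultimately have "casimir_pair s mult one v (tensor_sum s ?es)"
    unfolding casimir_pair_def by blast
  moreover have "tensor_sum s ?es \<in> tensor_square s"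
    by (simp add: tensor_sum_def tensor_square_def)
  ultimately show ?thesis by blast
qed

text \<open>Contracting the Casimir identity with \<open>v\<close> gives the reproducing formula
  \<open>a = a \<cdot> \<Sum> v (e\<^sup>2) e\<^sup>1 = \<Sum> v (e\<^sup>2 \<cdot> a) e\<^sup>1\<close>.\<close>

lemma casimir_pair_imp_nondegenerate:
  assumes v: "v \<in> dual s" and "casimir_pair s mult one v e"
    and zero: "\<And>b. v (mult a b) = 0"
  shows "a = 0"
proof -
  obtain es where
    cas: "tensor_sum s (map (\<lambda>(x, y). (mult a x, y)) es)
        = tensor_sum s (map (\<lambda>(x, y). (x, mult y a)) es)"
    and one: "(\<Sum>(x, y)\<leftarrow>es. s (v y) x) = one"
    using assms(2) unfolding casimir_pair_def by blast
  have "mult a (\<Sum>(x, y)\<leftarrow>es. s (v y) x) = (\<Sum>(x, y)\<leftarrow>map (\<lambda>(x, y). (mult a x, y)) es. s (v y) x)"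
    by (induction es) (auto simp: bil)
  also have "\<dots> = (\<Sum>(x, y)\<leftarrow>map (\<lambda>(x, y). (x, mult y a)) es. s (v y) x)"
    by (rule tensor_sum_contract(2)[OF vector_space_axioms v cas])
  also have "\<dots> = 0"
    by (induction es) (auto simp: zero mult_commute[of _ a])
  finally show ?thesis by (simp add: one mult_one_right)
qed

end

theorem theorem3p10:
  fixes s :: "'k::field \<Rightarrow> 'a::ab_group_add \<Rightarrow> 'a"
    and mult circ :: "'a \<Rightarrow> 'a \<Rightarrow> 'a" and one :: 'a
  assumes "jacobi_novikov_poisson s mult one circ"
    and "finite_dimensional s"
  shows "(frobenius_jnp s mult one circ \<longleftrightarrow> (\<exists>B. quadratic_jnp s mult one circ B)) \<and>
    ((\<exists>B. quadratic_jnp s mult one circ B) \<longleftrightarrow> (\<exists>v. nondegenerate_integral s mult circ v)) \<and>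
    ((\<exists>v. nondegenerate_integral s mult circ v) \<longleftrightarrow>
      (\<exists>v. \<exists>e\<in>tensor_square s. is_integral s mult circ v \<and> casimir_pair s mult one v e))"
proof -
  interpret jacobi_novikov_poisson s mult one circ by fact
  have bc: "(\<exists>B. quadratic_jnp s mult one circ B) \<longleftrightarrow> (\<exists>v. nondegenerate_integral s mult circ v)"
    using quadratic_imp_nondegenerate_integral nondegenerate_integral_imp_quadratic by blast
  have ab: "frobenius_jnp s mult one circ \<longleftrightarrow> (\<exists>B. quadratic_jnp s mult one circ B)"
    using quadratic_imp_frobenius[OF _ assms(2)] frobenius_imp_nondegenerate_integral bc by blast
  have "\<exists>v. \<exists>e\<in>tensor_square s. is_integral s mult circ v \<and> casimir_pair s mult one v e"
    if "nondegenerate_integral s mult circ v" for v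
    using that nondegenerate_integral_imp_casimir_pair[OF that assms(2)]
    by (auto simp: nondegenerate_integral_def)
  moreover have "nondegenerate_integral s mult circ v"
    if "is_integral s mult circ v" "casimir_pair s mult one v e" for v e
    using that casimir_pair_imp_nondegenerate[of v e]
    by (auto simp: nondegenerate_integral_def is_integral_def)
  ultimately show ?thesis using ab bc by blast
qed

end
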